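(* Let $\mathcal{G}$ be a hereditary class of graphs with a finite set of forbidden induced subgraphs. Then the edge-add class $\mathcal{G}^{+}$ of $\mathcal{G}$ is hereditary and also has a finite set of forbidden induced subgraphs.
   Context: All graphs are simple, finite and undirected. An induced subgraph of $G$ is a graph obtained from $G$ by a sequence of vertex deletions. A class of graphs is hereditary if it is closed under taking induced subgraphs. For a hereditary class $\mathcal{G}$, a forbidden induced subgraph for $\mathcal{G}$ is a graph $H$ not in $\mathcal{G}$ all of whose proper induced subgraphs are in $\mathcal{G}$. A non-edge of $G$ is an edge of the complement $\overline{G}$; for a non-edge $e$, $G+e$ is the graph obtained by adding $e$. The edge-add class $\mathcal{G}^{+}$ of $\mathcal{G}$ is the class of graphs $G$ such that $G\in\mathcal{G}$ or $G$ has a non-edge $e$ with $G+e\in\mathcal{G}$. *)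

theory Defs
  imports
    "Graph_Theory.Pair_Digraph"
    "Graph_Theory.Digraph_Component"
    "Graph_Theory.Digraph_Isomorphism"
    "HOL-Library.Infinite_Typeclass"
begin

text \<open>
  Finite simple undirected graphs are the library's \<^const>\<open>pair_graph\<close>s: finite loopless
  symmetric digraphs without parallel arcs, an edge \<open>uv\<close> being the two arcs \<open>(u, v)\<close> and \<open>(v, u)\<close>.
  The graph without vertices is included. Graph classes consist of graphs with vertices
  in one type; if that type is infinite, every finite graph has an isomorphic copy there, so an
  isomorphism-closed set of such graphs is the same thing as a class of abstract finite graphs.
\<close>

abbreviation graph_iso :: "'a pair_pre_digraph \<Rightarrow> 'a pair_pre_digraph \<Rightarrow> bool" where
  "graph_iso G H \<equiv> digraph_iso (with_proj G) (with_proj H)"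

abbreviation is_induced_subgraph :: "'a pair_pre_digraph \<Rightarrow> 'a pair_pre_digraph \<Rightarrow> bool" where
  "is_induced_subgraph H G \<equiv> induced_subgraph (with_proj H) (with_proj G)"

definition graph_class :: "'a pair_pre_digraph set \<Rightarrow> bool" where
  "graph_class \<G> \<longleftrightarrow>
    (\<forall>G\<in>\<G>. pair_graph G) \<and>
    (\<forall>G\<in>\<G>. \<forall>H. pair_graph H \<and> graph_iso G H \<longrightarrow> H \<in> \<G>)"

definition hereditary_class :: "'a pair_pre_digraph set \<Rightarrow> bool" where
  "hereditary_class \<G> \<longleftrightarrow>
    graph_class \<G> \<and> (\<forall>G\<in>\<G>. \<forall>H. is_induced_subgraph H G \<longrightarrow> H \<in> \<G>)"

definition forbidden_induced_subgraphs ::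
    "'a pair_pre_digraph set \<Rightarrow> 'a pair_pre_digraph set" where
  "forbidden_induced_subgraphs \<G> =
    {H. pair_graph H \<and> H \<notin> \<G> \<and> (\<forall>K. is_induced_subgraph K H \<and> K \<noteq> H \<longrightarrow> K \<in> \<G>)}"

text \<open>
  A nonempty graph has infinitely many isomorphic copies, so finiteness of a set of graphs
  means finiteness up to isomorphism.
\<close>

definition finite_up_to_iso :: "'a pair_pre_digraph set \<Rightarrow> bool" where
  "finite_up_to_iso F \<longleftrightarrow> (\<exists>R\<subseteq>F. finite R \<and> (\<forall>H\<in>F. \<exists>K\<in>R. graph_iso H K))"

definition graph_complement :: "'a pair_pre_digraph \<Rightarrow> 'a pair_pre_digraph" where
  "graph_complement G =
    \<lparr>pverts = pverts G,
     parcs = {(u, v). u \<in> pverts G \<and> v \<in> pverts G \<and> u \<noteq> v \<and> (u, v) \<notin> parcs G}\<rparr>"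

definition add_edge :: "'a pair_pre_digraph \<Rightarrow> 'a \<times> 'a \<Rightarrow> 'a pair_pre_digraph" where
  "add_edge G e =
    \<lparr>pverts = pverts G, parcs = parcs G \<union> {(fst e, snd e), (snd e, fst e)}\<rparr>"

definition edge_add_class :: "'a pair_pre_digraph set \<Rightarrow> 'a pair_pre_digraph set" where
  "edge_add_class \<G> =
    {G. pair_graph G \<and> (G \<in> \<G> \<or> (\<exists>e\<in>parcs (graph_complement G). add_edge G e \<in> \<G>))}"

end

theory Submission
  imports Defs
begin

text \<open>
  Let \<open>G\<close> be a minimal graph outside \<open>\<G>\<^sup>+\<close>, and let \<open>c\<close> bound the number of vertices of the
  forbidden induced subgraphs of \<open>\<G>\<close>. Then \<open>G\<close> induces a forbidden subgraph on some vertex set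
  \<open>S\<close>, and adding a non-edge not contained in \<open>S\<close> does not destroy it. For each of the at most
  \<open>c\<^sup>2\<close> non-edges \<open>e\<close> in \<open>S\<close>, the graph \<open>G + e\<close> induces a forbidden subgraph on some vertex
  set \<open>T e\<close>. The subgraph of \<open>G\<close> induced by the union of \<open>S\<close> and all \<open>T e\<close> is already outside
  \<open>\<G>\<^sup>+\<close>, so by minimality it is \<open>G\<close>, which therefore has at most \<open>c + c\<^sup>2 c\<close> vertices.
\<close>

text \<open>The vertex set is \<open>S\<close> itself, not its intersection with
  \<open>pverts G\<close>, so the simp rules carry no side condition. The result is an induced
  subgraph of \<open>G\<close> only for \<open>S \<subseteq> pverts G\<close>.\<close>

definition induce :: "'a pair_pre_digraph \<Rightarrow> 'a set \<Rightarrow> 'a pair_pre_digraph" where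
  "induce G S = \<lparr>pverts = S, parcs = parcs G \<inter> S \<times> S\<rparr>"

text \<open>Relabelling of vertices, meant for \<open>f\<close> injective on
  \<open>pverts G\<close>: merging two adjacent vertices would create a loop.\<close>

definition map_graph :: "('a \<Rightarrow> 'b) \<Rightarrow> 'a pair_pre_digraph \<Rightarrow> 'b pair_pre_digraph" where
  "map_graph f G = \<lparr>pverts = f ` pverts G, parcs = map_prod f f ` parcs G\<rparr>"

lemma induce_simps [simp]:
  "pverts (induce G S) = S" "parcs (induce G S) = parcs G \<inter> S \<times> S"
  by (simp_all add: induce_def)

lemma map_graph_simps [simp]:
  "pverts (map_graph f G) = f ` pverts G" "parcs (map_graph f G) = map_prod f f ` parcs G"
  by (simp_all add: map_graph_def)

lemma add_edge_simps [simp]: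
  "pverts (add_edge G e) = pverts G"
  "parcs (add_edge G e) = parcs G \<union> {(fst e, snd e), (snd e, fst e)}"
  by (simp_all add: add_edge_def)

lemma in_complement_iff [simp]:
  "(u, v) \<in> parcs (graph_complement G) \<longleftrightarrow>
    u \<in> pverts G \<and> v \<in> pverts G \<and> u \<noteq> v \<and> (u, v) \<notin> parcs G"
  by (simp add: graph_complement_def)

section \<open>Graphs, induced subgraphs and isomorphism in terms of vertex sets and vertex
  maps\<close>

lemma pair_graph_iff:
  "pair_graph G \<longleftrightarrow>
    finite (pverts G) \<and> parcs G \<subseteq> pverts G \<times> pverts G \<and> sym (parcs G) \<and> irrefl (parcs G)"
proof
  assume "pair_graph G"
  then interpret pair_graph G .
  show "finite (pverts G) \<and> parcs G \<subseteq> pverts G \<times> pverts G \<and> sym (parcs G) \<and> irrefl (parcs G)"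
    using pair_finite_verts in_arcsD1 in_arcsD2 arcs_symmetric no_loops'
    by (fastforce simp: sym_def irrefl_def)
next
  assume *: "finite (pverts G) \<and> parcs G \<subseteq> pverts G \<times> pverts G \<and> sym (parcs G) \<and> irrefl (parcs G)"
  then have "finite (parcs G)"
    by (meson finite_SigmaI finite_subset)
  with * show "pair_graph G"
    by unfold_locales (auto simp: irrefl_def symmetric_def)
qed

text \<open>The well-formedness conditions inside \<open>induced_subgraph\<close> come for free:
  \<open>G\<close> is a graph, and arcs restricted to \<open>pverts H\<close> have their ends there.
  Induced subgraphs of \<open>G\<close> thus correspond to subsets of its vertex set.\<close>

lemma is_induced_subgraph_iff:
  assumes "pair_graph G"
  shows "is_induced_subgraph H G \<longleftrightarrow> pverts H \<subseteq> pverts G \<and> induce G (pverts H) = H"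
proof -
  have G: "pair_wf_digraph G"
    using assms by (simp add: pair_graph.axioms pair_digraph.pair_wf_digraph)
  have eq: "induce G (pverts H) = H \<longleftrightarrow> parcs H = parcs G \<inter> pverts H \<times> pverts H"
    by (cases H) (auto simp: induce_def)
  have arcs: "{e \<in> parcs G. fst e \<in> pverts H \<and> snd e \<in> pverts H} = parcs G \<inter> pverts H \<times> pverts H"
    by auto
  have "pair_wf_digraph H" if "parcs H = parcs G \<inter> pverts H \<times> pverts H"
    unfolding pair_wf_digraph_def that by simp
  with G show ?thesis
    unfolding induced_subgraph_def subgraph_def eq
    by (auto simp: wf_digraph_wp_iff arcs)
qed

text \<open>A library isomorphism has separate vertex, arc, head and tail maps. Under
  \<open>with_proj\<close> head and tail are the projections on both sides, which forces the arc map
  to act on arcs as \<open>map_prod\<close> of the vertex map.\<close>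

lemma graph_iso_iff:
  assumes "pair_graph G"
  shows "graph_iso G H \<longleftrightarrow> (\<exists>f. inj_on f (pverts G) \<and> H = map_graph f G)"
proof
  assume "graph_iso G H"
  then obtain f where f: "pre_digraph.digraph_isomorphism (with_proj G) f"
    "with_proj H = app_iso f (with_proj G)"
    by (auto simp: digraph_iso_def)
  have "verts (with_proj H) = verts (app_iso f (with_proj G))"
    "arcs (with_proj H) = arcs (app_iso f (with_proj G))"
    "tail (with_proj H) = tail (app_iso f (with_proj G))"
    "head (with_proj H) = head (app_iso f (with_proj G))"
    by (simp_all only: f(2))
  then have H: "pverts H = iso_verts f ` pverts G" "parcs H = iso_arcs f ` parcs G"
    "iso_tail f = fst" "iso_head f = snd"
    by simp_all
  have "iso_arcs f a = map_prod (iso_verts f) (iso_verts f) a" if "a \<in> parcs G" for a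
    using f(1) that H(3,4)
    by (auto simp: pre_digraph.digraph_isomorphism_def map_prod_def split_beta prod_eq_iff)
  then have "parcs H = map_prod (iso_verts f) (iso_verts f) ` parcs G"
    unfolding H(2) by (intro image_cong) auto
  then have "H = map_graph (iso_verts f) G"
    using H(1) by (simp add: map_graph_def)
  then show "\<exists>f. inj_on f (pverts G) \<and> H = map_graph f G"
    using f(1) by (auto simp: pre_digraph.digraph_isomorphism_def)
next
  assume "\<exists>f. inj_on f (pverts G) \<and> H = map_graph f G"
  then obtain f where f: "inj_on f (pverts G)" "H = map_graph f G"
    by blast
  define h where "h = \<lparr>iso_verts = f, iso_arcs = map_prod f f, iso_head = snd, iso_tail = fst\<rparr>"
  have "parcs G \<subseteq> pverts G \<times> pverts G" using assms by (simp add: pair_graph_iff)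
  then have "inj_on (map_prod f f) (parcs G)"
    using map_prod_inj_on[OF f(1) f(1)] inj_on_subset by blast
  moreover have "wf_digraph (with_proj G)"
    using assms by (simp add: pair_graph.axioms pair_digraph.pair_wf_digraph wf_digraph_wp_iff)
  ultimately have "pre_digraph.digraph_isomorphism (with_proj G) h"
    using f(1) by (auto simp: pre_digraph.digraph_isomorphism_def h_def)
  moreover have "with_proj H = app_iso h (with_proj G)"
    by (simp add: f(2) h_def app_iso_def with_proj_def)
  ultimately show "graph_iso G H"
    by (auto simp: digraph_iso_def)
qed

lemma graph_iso_sym: "pair_graph G \<Longrightarrow> graph_iso G H \<Longrightarrow> graph_iso H G"
  by (simp add: digraph_iso_swap pair_digraph.pair_wf_digraph pair_graph.axioms wf_digraph_wp_iff)

lemma pair_graph_induce: "pair_graph G \<Longrightarrow> S \<subseteq> pverts G \<Longrightarrow> pair_graph (induce G S)"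
  by (auto simp: pair_graph_iff sym_def irrefl_def finite_subset)

lemma pair_graph_map_graph:
  assumes "pair_graph G" and f: "inj_on f (pverts G)"
  shows "pair_graph (map_graph f G)"
proof -
  have G: "finite (pverts G)" "parcs G \<subseteq> pverts G \<times> pverts G" "sym (parcs G)" "irrefl (parcs G)"
    using assms(1) by (simp_all add: pair_graph_iff)
  have "sym (map_prod f f ` parcs G)"
    using G(3) by (force simp: sym_def)
  moreover have "irrefl (map_prod f f ` parcs G)"
  proof (rule irreflI, rule notI)
    fix a assume "(a, a) \<in> map_prod f f ` parcs G"
    then obtain x y where xy: "(x, y) \<in> parcs G" "f x = f y" by auto
    then have "x = y" using f G(2) by (blast dest: inj_onD)
    with xy G(4) show False by (auto simp: irrefl_def)
  qed
  moreover have "map_prod f f ` parcs G \<subseteq> f ` pverts G \<times> f ` pverts G"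
    using G(2) by auto
  ultimately show ?thesis
    using G(1) by (simp add: pair_graph_iff)
qed

lemma pair_graph_add_edge:
  "pair_graph G \<Longrightarrow> e \<in> parcs (graph_complement G) \<Longrightarrow> pair_graph (add_edge G e)"
  by (cases e) (auto simp: pair_graph_iff sym_def irrefl_def)

lemma induce_pverts: "pair_graph G \<Longrightarrow> induce G (pverts G) = G"
  by (simp add: induce_def pair_graph_iff Int_absorb2)

lemma is_induced_subgraph_induce:
  "pair_graph G \<Longrightarrow> S \<subseteq> pverts G \<Longrightarrow> is_induced_subgraph (induce G S) G"
  by (simp add: is_induced_subgraph_iff)

lemma induce_induce: "S \<subseteq> T \<Longrightarrow> induce (induce G T) S = induce G S"
  by (auto simp: induce_def)

text \<open>An added edge with at most one end in \<open>S\<close> vanishes on restriction; this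
  dichotomy drives both the heredity proof and the vertex bound.\<close>

lemma induce_add_edge:
  "e \<in> S \<times> S \<Longrightarrow> induce (add_edge G e) S = add_edge (induce G S) e"
  "e \<notin> S \<times> S \<Longrightarrow> induce (add_edge G e) S = induce G S"
  by (cases e; auto simp: induce_def add_edge_def)+

lemma map_graph_add_edge: "map_graph f (add_edge G e) = add_edge (map_graph f G) (map_prod f f e)"
  by (cases e) (simp add: map_graph_def add_edge_def image_Un)

section \<open>Hereditary classes and their forbidden induced subgraphs\<close>

lemma hereditary_class_pair_graph: "hereditary_class \<G> \<Longrightarrow> G \<in> \<G> \<Longrightarrow> pair_graph G"
  unfolding hereditary_class_def graph_class_def by blast

lemma hereditary_class_induce:
  "hereditary_class \<G> \<Longrightarrow> G \<in> \<G> \<Longrightarrow> S \<subseteq> pverts G \<Longrightarrow> induce G S \<in> \<G>"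
  by (meson hereditary_class_def hereditary_class_pair_graph is_induced_subgraph_induce)

lemma hereditary_class_map_graph:
  assumes "hereditary_class \<G>" "G \<in> \<G>" "inj_on f (pverts G)"
  shows "map_graph f G \<in> \<G>"
proof -
  have pg: "pair_graph G" using assms(1,2) by (rule hereditary_class_pair_graph)
  then have "graph_iso G (map_graph f G)"
    using assms(3) graph_iso_iff by blast
  then show ?thesis
    using assms(1,2) pair_graph_map_graph[OF pg assms(3)]
    unfolding hereditary_class_def graph_class_def by blast
qed

lemma hereditary_classI:
  assumes "\<And>G. G \<in> \<G> \<Longrightarrow> pair_graph G"
    and "\<And>G f. G \<in> \<G> \<Longrightarrow> inj_on f (pverts G) \<Longrightarrow> map_graph f G \<in> \<G>"
    and "\<And>G S. G \<in> \<G> \<Longrightarrow> S \<subseteq> pverts G \<Longrightarrow> induce G S \<in> \<G>"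
  shows "hereditary_class \<G>"
proof -
  have "H \<in> \<G>" if "G \<in> \<G>" "graph_iso G H" for G H
    using that assms(1,2) by (auto simp: graph_iso_iff)
  moreover have "H \<in> \<G>" if "G \<in> \<G>" "is_induced_subgraph H G" for G H
    using that assms(3)[OF that(1), of "pverts H"] by (simp add: is_induced_subgraph_iff assms(1))
  ultimately show ?thesis
    using assms(1) unfolding hereditary_class_def graph_class_def by blast
qed

text \<open>The added non-edge \<open>e\<close> is carried along. Its image under an injective
  relabelling is again a non-edge. On restriction to \<open>S\<close>, either \<open>e\<close> lies
  inside \<open>S\<close> and remains a non-edge, or it vanishes and \<open>induce G S\<close> is
  already in \<open>\<G>\<close>.\<close>

lemma hereditary_edge_add_class:
  fixes \<G> :: "'a pair_pre_digraph set"
  assumes "hereditary_class \<G>"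
  shows "hereditary_class (edge_add_class \<G>)"
proof (rule hereditary_classI)
  fix G assume "G \<in> edge_add_class \<G>"
  then show "pair_graph G" by (simp add: edge_add_class_def)
next
  fix G and f :: "'a \<Rightarrow> 'a"
  assume G: "G \<in> edge_add_class \<G>" and f: "inj_on f (pverts G)"
  then have pg: "pair_graph G" by (simp add: edge_add_class_def)
  have pm: "pair_graph (map_graph f G)" using pair_graph_map_graph[OF pg f] .
  show "map_graph f G \<in> edge_add_class \<G>"
  proof (cases "G \<in> \<G>")
    case True
    then show ?thesis
      using pm hereditary_class_map_graph[OF assms _ f] by (simp add: edge_add_class_def)
  next
    case False
    with G obtain u v where e: "(u, v) \<in> parcs (graph_complement G)" "add_edge G (u, v) \<in> \<G>"
      by (auto simp: edge_add_class_def)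
    have "add_edge (map_graph f G) (f u, f v) \<in> \<G>"
      using hereditary_class_map_graph[OF assms e(2), of f] f by (simp add: map_graph_add_edge)
    moreover have "(f u, f v) \<in> parcs (graph_complement (map_graph f G))"
    proof -
      have "(f u, f v) \<notin> map_prod f f ` parcs G"
      proof
        assume "(f u, f v) \<in> map_prod f f ` parcs G"
        then obtain x y where xy: "(x, y) \<in> parcs G" "f u = f x" "f v = f y"
          by (auto simp: map_prod_def)
        then have "x \<in> pverts G" "y \<in> pverts G"
          using pg by (auto simp: pair_graph_iff)
        then have "x = u" "y = v"
          using f xy e(1) by (auto dest: inj_onD)
        then show False using xy e(1) by simp
      qed
      then show ?thesis using e(1) f by (auto dest: inj_onD)
    qed
    ultimately show ?thesis
      using pm by (auto simp: edge_add_class_def)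
  qed
next
  fix G S assume G: "G \<in> edge_add_class \<G>" and S: "S \<subseteq> pverts G"
  then have pS: "pair_graph (induce G S)"
    by (simp add: edge_add_class_def pair_graph_induce)
  show "induce G S \<in> edge_add_class \<G>"
  proof (cases "G \<in> \<G>")
    case True
    then show ?thesis
      using pS hereditary_class_induce[OF assms _ S] by (simp add: edge_add_class_def)
  next
    case False
    with G obtain e where e: "e \<in> parcs (graph_complement G)" "add_edge G e \<in> \<G>"
      by (auto simp: edge_add_class_def)
    have "induce (add_edge G e) S \<in> \<G>"
      using hereditary_class_induce[OF assms e(2)] S by simp
    moreover have "e \<in> parcs (graph_complement (induce G S))" if "e \<in> S \<times> S"
      using that e(1) by (cases e) auto
    ultimately show ?thesis
      using pS by (cases "e \<in> S \<times> S") (auto simp: edge_add_class_def induce_add_edge)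
  qed
qed

text \<open>Take \<open>S\<close> inclusion-minimal among the finitely many vertex sets inducing a
  graph outside \<open>\<G>\<close>; \<open>pverts G\<close> is one of them.\<close>

lemma exists_forbidden_induced_subgraph:
  assumes "hereditary_class \<G>" "pair_graph G" "G \<notin> \<G>"
  shows "\<exists>S\<subseteq>pverts G. induce G S \<in> forbidden_induced_subgraphs \<G>"
proof -
  let ?A = "{S. S \<subseteq> pverts G \<and> induce G S \<notin> \<G>}"
  have "pverts G \<in> ?A" "finite ?A"
    using assms(2,3) by (auto simp: pair_graph_iff induce_pverts)
  then obtain S where S: "S \<in> ?A" and min: "\<And>T. T \<in> ?A \<Longrightarrow> T \<subseteq> S \<Longrightarrow> T = S"
    using finite_has_minimal[of ?A] by (metis (lifting) empty_iff)
  have pS: "pair_graph (induce G S)"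
    using S assms(2) by (simp add: pair_graph_induce)
  have "K \<in> \<G>" if K: "is_induced_subgraph K (induce G S)" "K \<noteq> induce G S" for K
  proof (rule ccontr)
    assume "K \<notin> \<G>"
    have K': "pverts K \<subseteq> S" "induce G (pverts K) = K"
      using K(1) unfolding is_induced_subgraph_iff[OF pS] by (auto simp: induce_induce)
    with \<open>K \<notin> \<G>\<close> S have "pverts K \<in> ?A" by auto
    with min K' have "pverts K = S" by blast
    with K' K(2) show False by simp
  qed
  with pS S show ?thesis
    by (auto simp: forbidden_induced_subgraphs_def)
qed

lemma forbidden_induced_subgraph_eq_induceD:
  assumes "G \<in> forbidden_induced_subgraphs \<G>" "S \<subseteq> pverts G" "induce G S \<notin> \<G>"
  shows "S = pverts G"
proof -
  have "induce G S = G"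
    using assms is_induced_subgraph_induce unfolding forbidden_induced_subgraphs_def by blast
  then show ?thesis by (metis induce_simps(1))
qed

section \<open>Finiteness up to isomorphism as a bound on the number of vertices\<close>

lemma finite_up_to_iso_imp_card_bounded:
  assumes "finite_up_to_iso F" "\<And>H. H \<in> F \<Longrightarrow> pair_graph H"
  shows "\<exists>c. \<forall>H\<in>F. card (pverts H) \<le> c"
proof -
  obtain R where R: "finite R" "\<And>H. H \<in> F \<Longrightarrow> \<exists>K\<in>R. graph_iso H K"
    using assms(1) unfolding finite_up_to_iso_def by blast
  have "card (pverts H) \<le> Max ((\<lambda>K. card (pverts K)) ` R)" if H: "H \<in> F" for H
  proof -
    obtain K where K: "K \<in> R" "graph_iso H K" using R H by blast
    then have "card (pverts K) = card (pverts H)"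
      using assms(2)[OF H] by (auto simp: graph_iso_iff card_image)
    then show ?thesis
      using R(1) K(1) by (metis Max_ge finite_imageI image_eqI)
  qed
  then show ?thesis by blast
qed

text \<open>An infinite vertex type contains a set \<open>A\<close> of \<open>n\<close> elements.
  Every graph in \<open>F\<close> has a copy on a subset of \<open>A\<close>, and only finitely many
  graphs live there.\<close>

lemma card_bounded_imp_finite_up_to_iso:
  fixes F :: "'a::infinite pair_pre_digraph set"
  assumes "\<And>H. H \<in> F \<Longrightarrow> pair_graph H" "\<And>H. H \<in> F \<Longrightarrow> card (pverts H) \<le> n"
  shows "finite_up_to_iso F"
proof -
  obtain A :: "'a set" where A: "finite A" "card A = n"
    using infinite_arbitrarily_large[OF infinite_UNIV] by blast
  define M where "M = {K. pair_graph K \<and> pverts K \<subseteq> A \<and> (\<exists>H\<in>F. graph_iso H K)}"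
  have "M \<subseteq> (\<lambda>(V, E). \<lparr>pverts = V, parcs = E\<rparr>) ` (Pow A \<times> Pow (A \<times> A))"
  proof
    fix K assume K: "K \<in> M"
    then have "(pverts K, parcs K) \<in> Pow A \<times> Pow (A \<times> A)"
      by (auto simp: M_def pair_graph_iff)
    moreover have "K = (\<lambda>(V, E). \<lparr>pverts = V, parcs = E\<rparr>) (pverts K, parcs K)"
      by simp
    ultimately show "K \<in> (\<lambda>(V, E). \<lparr>pverts = V, parcs = E\<rparr>) ` (Pow A \<times> Pow (A \<times> A))"
      by blast
  qed
  then have "finite M"
    using A(1) by (meson finite_Pow_iff finite_SigmaI finite_imageI finite_subset)
  have "\<forall>K\<in>M. \<exists>H. H \<in> F \<and> graph_iso H K"
    unfolding M_def by blast
  \<comment> \<open>The copies in \<open>M\<close> need not belong to \<open>F\<close>, but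
    representatives must, so \<open>r\<close> picks for each copy an isomorphic member of
    \<open>F\<close>.\<close>
  then obtain r where r: "\<And>K. K \<in> M \<Longrightarrow> r K \<in> F \<and> graph_iso (r K) K"
    by (metis (no_types, lifting))
  have "\<exists>K\<in>r ` M. graph_iso H K" if H: "H \<in> F" for H
  proof -
    have "finite (pverts H)" using assms(1)[OF H] by (simp add: pair_graph_iff)
    then obtain f where f: "inj_on f (pverts H)" "f ` pverts H \<subseteq> A"
      using card_le_inj[of "pverts H" A] A assms(2)[OF H] by blast
    have iso: "graph_iso H (map_graph f H)"
      using assms(1)[OF H] f(1) by (auto simp: graph_iso_iff)
    have "map_graph f H \<in> M"
      using iso f H pair_graph_map_graph[OF assms(1)[OF H] f(1)] by (auto simp: M_def)
    then have "graph_iso H (r (map_graph f H))"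
      using r iso graph_iso_sym assms(1) digraph_iso_trans by metis
    with \<open>map_graph f H \<in> M\<close> show ?thesis by blast
  qed
  moreover have "r ` M \<subseteq> F" "finite (r ` M)"
    using r \<open>finite M\<close> by auto
  ultimately show ?thesis
    unfolding finite_up_to_iso_def by blast
qed

section \<open>The vertex bound for forbidden induced subgraphs of the edge-add class\<close>

lemma card_forbidden_edge_add_class_le:
  assumes her: "hereditary_class \<G>"
    and c: "\<And>H. H \<in> forbidden_induced_subgraphs \<G> \<Longrightarrow> card (pverts H) \<le> c"
    and G: "G \<in> forbidden_induced_subgraphs (edge_add_class \<G>)"
  shows "card (pverts G) \<le> c + c\<^sup>2 * c"
proof -
  have pg: "pair_graph G" and G_notin: "G \<notin> edge_add_class \<G>"
    using G by (auto simp: forbidden_induced_subgraphs_def)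
  then have fin: "finite (pverts G)" by (simp add: pair_graph_iff)
  let ?N = "parcs (graph_complement G)"
  \<comment> \<open>Being outside \<open>edge_add_class \<G>\<close> means that \<open>G\<close> is
    outside \<open>\<G>\<close>, which yields \<open>S\<close>, and that every
    \<open>add_edge G e\<close> is too, which yields the sets \<open>T e\<close>.\<close>
  obtain S where S: "S \<subseteq> pverts G" "induce G S \<in> forbidden_induced_subgraphs \<G>"
    using exists_forbidden_induced_subgraph[OF her pg] G_notin pg
    by (auto simp: edge_add_class_def)
  have "\<exists>T\<subseteq>pverts G. induce (add_edge G e) T \<in> forbidden_induced_subgraphs \<G>" if "e \<in> ?N" for e
    using exists_forbidden_induced_subgraph[OF her pair_graph_add_edge[OF pg that]] G_notin pg that
    by (auto simp: edge_add_class_def)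
  then obtain T where T: "\<And>e. e \<in> ?N \<Longrightarrow> T e \<subseteq> pverts G"
    "\<And>e. e \<in> ?N \<Longrightarrow> induce (add_edge G e) (T e) \<in> forbidden_induced_subgraphs \<G>"
    by metis
  \<comment> \<open>Only non-edges inside \<open>S\<close> are indexed, so their number is bounded
    in terms of \<open>c\<close> alone. They are ordered pairs, both orientations occurring, hence
    the bound \<open>c\<^sup>2\<close>.\<close>
  define X where "X = S \<union> (\<Union>e\<in>?N \<inter> S \<times> S. T e)"
  have X: "X \<subseteq> pverts G" using S(1) T(1) by (auto simp: X_def)
  \<comment> \<open>Heredity in contrapositive form: a forbidden graph induced on any
    \<open>U\<close> keeps \<open>H\<close> out of \<open>\<G>\<close>.\<close>
  have notin: "H \<notin> \<G>"
    if "U \<subseteq> pverts H" "induce H U \<in> forbidden_induced_subgraphs \<G>" for H U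
    using hereditary_class_induce[OF her _ that(1)] that(2)
    by (auto simp: forbidden_induced_subgraphs_def)
  have "S \<subseteq> X" by (simp add: X_def)
  then have "induce G X \<notin> \<G>"
    using S(2) by (intro notin[of S]) (auto simp: induce_induce)
  moreover have "add_edge (induce G X) e \<notin> \<G>"
    if e: "e \<in> parcs (graph_complement (induce G X))" for e
  proof -
    have eX: "e \<in> X \<times> X" and eN: "e \<in> ?N"
      using e X by (cases e; auto)+
    \<comment> \<open>Since \<open>e\<close> lies inside \<open>X\<close>, adding it commutes with
      restricting to \<open>X\<close>. The obstruction is \<open>T e\<close> if \<open>e\<close>
      lies inside \<open>S\<close>; otherwise it is \<open>S\<close>, on which \<open>e\<close> has
      no effect.\<close>
    have "induce (add_edge G e) X \<notin> \<G>"
    proof (cases "e \<in> S \<times> S")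
      case True
      then have "T e \<subseteq> X" using eN by (auto simp: X_def)
      then show ?thesis
        using T(2)[OF eN] by (intro notin[of "T e"]) (auto simp: induce_induce)
    next
      case False
      then show ?thesis
        using S(2) \<open>S \<subseteq> X\<close> by (intro notin[of S]) (auto simp: induce_induce induce_add_edge)
    qed
    then show ?thesis by (simp add: induce_add_edge(1)[OF eX])
  qed
  ultimately have "induce G X \<notin> edge_add_class \<G>"
    by (auto simp: edge_add_class_def)
  \<comment> \<open>Minimality of \<open>G\<close> forces \<open>X\<close> to be everything, so it
    remains to count \<open>X\<close>.\<close>
  then have "pverts G = X"
    using forbidden_induced_subgraph_eq_induceD[OF G X] by simp
  moreover have "card X \<le> c + c\<^sup>2 * c"
  proof -
    have "finite S" using S(1) fin finite_subset by blast
    have cS: "card S \<le> c" using c[OF S(2)] by simp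
    have "card (\<Union>e\<in>?N \<inter> S \<times> S. T e) \<le> (\<Sum>e\<in>?N \<inter> S \<times> S. card (T e))"
      using \<open>finite S\<close> by (intro card_UN_le) auto
    also have "\<dots> \<le> card (?N \<inter> S \<times> S) * c"
      using c[OF T(2)] sum_bounded_above[of "?N \<inter> S \<times> S" "\<lambda>e. card (T e)" c] by simp
    also have "\<dots> \<le> c\<^sup>2 * c"
    proof (rule mult_right_mono)
      have "card (?N \<inter> S \<times> S) \<le> card (S \<times> S)"
        using \<open>finite S\<close> by (intro card_mono) auto
      also have "\<dots> \<le> c\<^sup>2"
        using cS by (simp add: card_cartesian_product power2_eq_square mult_mono)
      finally show "card (?N \<inter> S \<times> S) \<le> c\<^sup>2" .
    qed simp
    finally show ?thesis
      using cS card_Un_le[of S "\<Union>e\<in>?N \<inter> S \<times> S. T e"] unfolding X_def by linarith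
  qed
  ultimately show ?thesis by simp
qed

theorem theorem1p2:
  fixes \<G> :: "'a::infinite pair_pre_digraph set"
  assumes "hereditary_class \<G>"
    and "finite_up_to_iso (forbidden_induced_subgraphs \<G>)"
  shows "hereditary_class (edge_add_class \<G>) \<and>
    finite_up_to_iso (forbidden_induced_subgraphs (edge_add_class \<G>))"
proof
  show "hereditary_class (edge_add_class \<G>)"
    using assms(1) by (rule hereditary_edge_add_class)
  obtain c where "\<forall>H\<in>forbidden_induced_subgraphs \<G>. card (pverts H) \<le> c"
    using finite_up_to_iso_imp_card_bounded[OF assms(2)]
    by (auto simp: forbidden_induced_subgraphs_def)
  then show "finite_up_to_iso (forbidden_induced_subgraphs (edge_add_class \<G>))"
    using card_forbidden_edge_add_class_le[OF assms(1)]
    by (intro card_bounded_imp_finite_up_to_iso[of _ "c + c\<^sup>2 * c"])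
       (auto simp: forbidden_induced_subgraphs_def)
qed

end
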